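(* Let $a,b,c\geq 1$ be integers and let $x$ be a complex number with $x^3\neq 1$. The (ordinary) generating function $g_{\mathcal{BJ}}(t;x)=\sum_{n\geq 0}\mathcal{BJ}_{n}^{(a,b,c)}(x)\,t^{n}$, as a formal power series in $t$, is $$g_{\mathcal{BJ}}(t;x)=\frac{\mathcal{BJ}_{0}^{(a,b,c)}(x)+\left(\mathcal{BJ}_{1}^{(a,b,c)}(x)-(x-1)\mathcal{BJ}_{0}^{(a,b,c)}(x)\right)t+ \left(\mathcal{BJ}_{2}^{(a,b,c)}(x)-(x-1)\mathcal{BJ}_{1}^{(a,b,c)}(x)-(x-1)\mathcal{BJ}_{0}^{(a,b,c)}(x)\right)t^{2}}{1-(x-1)t-(x-1)t^{2}-xt^{3}}.$$
   Context: The third-order Jacobsthal polynomials are defined, for $x^3\neq 1$, by $\mathcal{J}_{0}^{(3)}(x)=0$, $\mathcal{J}_{1}^{(3)}(x)=1$, $\mathcal{J}_{2}^{(3)}(x)=x-1$ and $\mathcal{J}_{n+3}^{(3)}(x)=(x-1)\mathcal{J}_{n+2}^{(3)}(x)+(x-1)\mathcal{J}_{n+1}^{(3)}(x)+x\mathcal{J}_{n}^{(3)}(x)$ for $n\geq 0$. Bihyperbolic numbers are the elements $a_0+a_1j_1+a_2j_2+a_3j_3$ with multiplication determined by $j_1^2=j_2^2=j_3^2=1$, $j_1j_2=j_2j_1=j_3$, $j_1j_3=j_3j_1=j_2$, $j_2j_3=j_3j_2=j_1$; this gives a commutative associative unital algebra with basis $1,j_1,j_2,j_3$ (over $\mathbb{R}$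 for bihyperbolic numbers proper). All identities are read in its complexification, i.e. coefficients $a_i$ are allowed to be complex. For integers $a,b,c\geq1$ and $n\geq 0$, the generalized bihyperbolic third-order Jacobsthal polynomial is $\mathcal{BJ}_{n}^{(a,b,c)}(x)=\mathcal{J}_{n}^{(3)}(x)+\mathcal{J}_{n+a}^{(3)}(x)j_{1}+\mathcal{J}_{n+b}^{(3)}(x)j_{2}+\mathcal{J}_{n+c}^{(3)}(x)j_{3}$. *)

theory Defs
  imports Complex_Main "HOL-Computational_Algebra.Formal_Power_Series"
begin

fun jacobsthal3 :: "nat \<Rightarrow> complex \<Rightarrow> complex" where
  "jacobsthal3 0 x = 0"
| "jacobsthal3 (Suc 0) x = 1"
| "jacobsthal3 (Suc (Suc 0)) x = x - 1"
| "jacobsthal3 (Suc (Suc (Suc n))) x =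
     (x - 1) * jacobsthal3 (Suc (Suc n)) x + (x - 1) * jacobsthal3 (Suc n) x + x * jacobsthal3 n x"

text \<open>
  Bihyperbolic numbers with complex coefficients:
  \<open>Bihyp p q r s\<close> stands for \<open>p + q j\<^sub>1 + r j\<^sub>2 + s j\<^sub>3\<close>.
\<close>

datatype bihyp = Bihyp (bi0: complex) (bi1: complex) (bi2: complex) (bi3: complex)

lemma bihyp_eq_iff:
  "u = v \<longleftrightarrow> bi0 u = bi0 v \<and> bi1 u = bi1 v \<and> bi2 u = bi2 v \<and> bi3 u = bi3 v"
  by (cases u; cases v) simp

instantiation bihyp :: comm_ring_1
begin

definition "0 = Bihyp 0 0 0 0"
definition "1 = Bihyp 1 0 0 0"
definition "u + v = Bihyp (bi0 u + bi0 v) (bi1 u + bi1 v) (bi2 u + bi2 v) (bi3 u + bi3 v)"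
definition "u - v = Bihyp (bi0 u - bi0 v) (bi1 u - bi1 v) (bi2 u - bi2 v) (bi3 u - bi3 v)"
definition "- u = Bihyp (- bi0 u) (- bi1 u) (- bi2 u) (- bi3 u)"

text \<open>
  The bilinear extension of \<open>j\<^sub>i j\<^sub>i = 1\<close> and \<open>j\<^sub>i j\<^sub>k = j\<^sub>l\<close> for \<open>{i, k, l} = {1, 2, 3}\<close>;
  see \<open>bihyp_unit_mult\<close> below.
\<close>
definition "u * v = Bihyp
  (bi0 u * bi0 v + bi1 u * bi1 v + bi2 u * bi2 v + bi3 u * bi3 v)
  (bi0 u * bi1 v + bi1 u * bi0 v + bi2 u * bi3 v + bi3 u * bi2 v)
  (bi0 u * bi2 v + bi2 u * bi0 v + bi1 u * bi3 v + bi3 u * bi1 v)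
  (bi0 u * bi3 v + bi3 u * bi0 v + bi1 u * bi2 v + bi2 u * bi1 v)"

lemma bihyp_sel [simp]:
  "bi0 0 = 0" "bi1 0 = 0" "bi2 0 = 0" "bi3 0 = 0"
  "bi0 1 = 1" "bi1 1 = 0" "bi2 1 = 0" "bi3 1 = 0"
  "bi0 (u + v) = bi0 u + bi0 v" "bi1 (u + v) = bi1 u + bi1 v"
  "bi2 (u + v) = bi2 u + bi2 v" "bi3 (u + v) = bi3 u + bi3 v"
  "bi0 (u - v) = bi0 u - bi0 v" "bi1 (u - v) = bi1 u - bi1 v"
  "bi2 (u - v) = bi2 u - bi2 v" "bi3 (u - v) = bi3 u - bi3 v"
  "bi0 (- u) = - bi0 u" "bi1 (- u) = - bi1 u" "bi2 (- u) = - bi2 u" "bi3 (- u) = - bi3 u"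
  "bi0 (u * v) = bi0 u * bi0 v + bi1 u * bi1 v + bi2 u * bi2 v + bi3 u * bi3 v"
  "bi1 (u * v) = bi0 u * bi1 v + bi1 u * bi0 v + bi2 u * bi3 v + bi3 u * bi2 v"
  "bi2 (u * v) = bi0 u * bi2 v + bi2 u * bi0 v + bi1 u * bi3 v + bi3 u * bi1 v"
  "bi3 (u * v) = bi0 u * bi3 v + bi3 u * bi0 v + bi1 u * bi2 v + bi2 u * bi1 v"
  by (simp_all only: zero_bihyp_def one_bihyp_def plus_bihyp_def minus_bihyp_def
      uminus_bihyp_def times_bihyp_def bihyp.sel)

instance
  by standard (simp_all add: bihyp_eq_iff algebra_simps)

end

definition j\<^sub>1 :: bihyp where "j\<^sub>1 = Bihyp 0 1 0 0"
definition j\<^sub>2 :: bihyp where "j\<^sub>2 = Bihyp 0 0 1 0"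
definition j\<^sub>3 :: bihyp where "j\<^sub>3 = Bihyp 0 0 0 1"

lemma bihyp_unit_mult:
  "j\<^sub>1 * j\<^sub>1 = 1" "j\<^sub>2 * j\<^sub>2 = 1" "j\<^sub>3 * j\<^sub>3 = 1"
  "j\<^sub>1 * j\<^sub>2 = j\<^sub>3" "j\<^sub>2 * j\<^sub>1 = j\<^sub>3"
  "j\<^sub>1 * j\<^sub>3 = j\<^sub>2" "j\<^sub>3 * j\<^sub>1 = j\<^sub>2"
  "j\<^sub>2 * j\<^sub>3 = j\<^sub>1" "j\<^sub>3 * j\<^sub>2 = j\<^sub>1"
  by (simp_all add: j\<^sub>1_def j\<^sub>2_def j\<^sub>3_def one_bihyp_def times_bihyp_def)

definition bihyp_of_complex :: "complex \<Rightarrow> bihyp" where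
  "bihyp_of_complex z = Bihyp z 0 0 0"

lemma Bihyp_eq:
  "Bihyp p q r s = bihyp_of_complex p + bihyp_of_complex q * j\<^sub>1
     + bihyp_of_complex r * j\<^sub>2 + bihyp_of_complex s * j\<^sub>3"
  by (simp add: bihyp_of_complex_def j\<^sub>1_def j\<^sub>2_def j\<^sub>3_def plus_bihyp_def times_bihyp_def)

text \<open>
  The algebra has zero divisors. Its inverse is the true inverse on units and, by convention, zero
  elsewhere. The library's division of formal power series takes its coefficientwise inverse
  from class \<^class>\<open>inverse\<close>; the lemma \<open>bihyp_fps_divide_eq_iff\<close> below shows that a quotient by a
  power series with constant coefficient 1 has its usual meaning.
\<close>

instantiation bihyp :: inverse
begin

definition "inverse (u :: bihyp) = (if u dvd 1 then THE v. u * v = 1 else 0)"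
definition "(u :: bihyp) div v = u * inverse v"

instance ..

end

lemma bihyp_inverse_unique:
  fixes u v :: bihyp
  assumes "u * v = 1"
  shows "inverse u = v"
proof -
  have "w = v" if "u * w = 1" for w
  proof -
    have "w = v * u * w" using assms by (simp add: mult.commute)
    also have "\<dots> = v" using that by (simp add: mult.assoc)
    finally show ?thesis .
  qed
  then have "(THE w. u * w = 1) = v"
    using assms by (intro the_equality)
  moreover have "u dvd 1"
    using assms by (intro dvdI[of 1 u v]) simp
  ultimately show ?thesis
    by (simp only: inverse_bihyp_def if_True)
qed

lemma bihyp_fps_divide_eq_iff:
  fixes f g h :: "bihyp fps"
  assumes "fps_nth g 0 = 1"
  shows "f / g = h \<longleftrightarrow> f = h * g"
proof -
  have inv1: "inverse (1 :: bihyp) = 1"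
    by (rule bihyp_inverse_unique) simp
  have gi: "g * inverse g = 1"
    using fps_right_inverse[of g 1] assms by (simp add: fps_inverse_def inv1)
  have "f / g = f * inverse g"
    using assms by (simp add: fps_divide_unit)
  moreover have "f * inverse g * g = f" and "h * g * inverse g = h"
    by (simp_all only: mult.assoc mult.commute[of "inverse g" g] gi mult_1_right)
  ultimately show ?thesis
    by metis
qed

definition BJ :: "nat \<Rightarrow> nat \<Rightarrow> nat \<Rightarrow> nat \<Rightarrow> complex \<Rightarrow> bihyp" where
  "BJ a b c n x =
     bihyp_of_complex (jacobsthal3 n x) + bihyp_of_complex (jacobsthal3 (n + a) x) * j\<^sub>1
     + bihyp_of_complex (jacobsthal3 (n + b) x) * j\<^sub>2
     + bihyp_of_complex (jacobsthal3 (n + c) x) * j\<^sub>3"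

definition BJ_gen_fun :: "nat \<Rightarrow> nat \<Rightarrow> nat \<Rightarrow> complex \<Rightarrow> bihyp fps" where
  "BJ_gen_fun a b c x = Abs_fps (\<lambda>n. BJ a b c n x)"

end

theory Submission
  imports Defs
begin

text \<open>
  Each of the four coordinates of \<open>BJ\<close> is a shift of the same scalar sequence, and a linear
  recurrence with constant coefficients survives shifts; hence \<open>BJ\<close> satisfies the third-order
  recurrence itself, with the scalars embedded in the algebra (\<open>BJ_recurrence\<close>). Multiplying
  the generating function of any such sequence by the reversed characteristic polynomial
  \<open>1 - p t - q t\<^sup>2 - r t\<^sup>3\<close> makes the recurrence cancel every coefficient from degree 3 on, and
  leaves a polynomial in the three initial values (\<open>fps_third_order_recurrence\<close>). The reversed
  characteristic polynomial has constant coefficient 1, so it is a unit of the power series ring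
  although the bihyperbolic numbers have zero divisors, and one may divide by it.
\<close>

text \<open>
  In degree \<open>n\<close> the product has the coefficient \<open>f n - p f (n - 1) - q f (n - 2) - r f (n - 3)\<close>,
  with terms of negative index dropped. For \<open>n \<ge> 3\<close> this vanishes by the recurrence; for smaller
  \<open>n\<close> the truncated expression is the numerator coefficient.
\<close>

lemma fps_third_order_recurrence:
  fixes f :: "nat \<Rightarrow> 'a::comm_ring_1"
  assumes rec: "\<And>n. f (n + 3) = p * f (n + 2) + q * f (n + 1) + r * f n"
  shows "fps_const (f 0) + fps_const (f 1 - p * f 0) * fps_X
           + fps_const (f 2 - p * f 1 - q * f 0) * fps_X ^ 2
         = Abs_fps f * (1 - fps_const p * fps_X - fps_const q * fps_X ^ 2
             - fps_const r * fps_X ^ 3)"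
    (is "?num = ?F * ?den")
proof -
  have expand: "?F * ?den = ?F - fps_const p * (?F * fps_X) - fps_const q * (?F * fps_X ^ 2)
      - fps_const r * (?F * fps_X ^ 3)"
    by (simp add: algebra_simps)
  have "fps_nth ?num n = fps_nth (?F * ?den) n" for n
  proof -
    consider "n = 0" | "n = 1" | "n = 2" | m where "n = m + 3"
      by (metis One_nat_def add.commute le_Suc_ex less_2_cases linorder_not_less
          less_Suc_eq numeral_3_eq_3 numeral_2_eq_2)
    then show ?thesis
    proof cases
      case 4
      have "m + 3 - 1 = m + 2" "m + 3 - 2 = m + 1" "m + 3 - 3 = m"
        by simp_all
      then show ?thesis
        unfolding expand \<open>n = m + 3\<close> using rec[of m]
        by (simp add: fps_X_power_mult_right_nth fps_X_power_nth)
    qed (simp_all add: expand fps_X_power_mult_right_nth fps_X_power_nth)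
  qed
  then show ?thesis
    by (rule fps_ext)
qed

lemma BJ_recurrence:
  "BJ a b c (n + 3) x = bihyp_of_complex (x - 1) * BJ a b c (n + 2) x
     + bihyp_of_complex (x - 1) * BJ a b c (n + 1) x + bihyp_of_complex x * BJ a b c n x"
proof -
  have shifted: "jacobsthal3 (n + 3 + k) x = (x - 1) * jacobsthal3 (n + 2 + k) x
      + (x - 1) * jacobsthal3 (n + 1 + k) x + x * jacobsthal3 (n + k) x" for k
    using jacobsthal3.simps(4)[of "n + k" x] by (simp add: numeral_eq_Suc)
  have coords: "BJ a b c m x = Bihyp (jacobsthal3 m x) (jacobsthal3 (m + a) x)
      (jacobsthal3 (m + b) x) (jacobsthal3 (m + c) x)" for m
    by (simp only: BJ_def Bihyp_eq)
  show ?thesis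
    unfolding coords shifted shifted[of 0, simplified]
    by (simp add: bihyp_eq_iff bihyp_of_complex_def)
qed

theorem theorem2p10:
  fixes a b c :: nat and x :: complex
  assumes "a \<ge> 1" and "b \<ge> 1" and "c \<ge> 1" and "x ^ 3 \<noteq> 1"
  shows "BJ_gen_fun a b c x =
    (fps_const (BJ a b c 0 x)
      + fps_const (BJ a b c 1 x - bihyp_of_complex (x - 1) * BJ a b c 0 x) * fps_X
      + fps_const (BJ a b c 2 x - bihyp_of_complex (x - 1) * BJ a b c 1 x
                     - bihyp_of_complex (x - 1) * BJ a b c 0 x) * fps_X ^ 2)
    / (1 - fps_const (bihyp_of_complex (x - 1)) * fps_X
         - fps_const (bihyp_of_complex (x - 1)) * fps_X ^ 2
         - fps_const (bihyp_of_complex x) * fps_X ^ 3)"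
proof -
  let ?p = "bihyp_of_complex (x - 1)" and ?r = "bihyp_of_complex x"
  let ?den = "1 - fps_const ?p * fps_X - fps_const ?p * fps_X ^ 2 - fps_const ?r * fps_X ^ 3"
  have "fps_nth ?den 0 = 1"
    by simp
  then show ?thesis
    unfolding BJ_gen_fun_def
    by (intro sym[OF iffD2[OF bihyp_fps_divide_eq_iff]]
        fps_third_order_recurrence[of "\<lambda>n. BJ a b c n x"] BJ_recurrence)
qed

end
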